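(* The additive group of the Schwartz locally convex space $\mathscr{S}(c_0)$, that is, of the vector space $c_0$ equipped with the topology $\tau_k(\ell_1)$ of uniform convergence on compact subsets of $\ell_1$, is not unitarily representable.
   Context: A topological group is called unitarily representable if it is topologically isomorphic to a subgroup of the unitary group $\mathcal{U}(\mathbb{H})$ of some Hilbert space $\mathbb{H}$ (of arbitrary dimension), where $\mathcal{U}(\mathbb{H})$ carries the strong operator topology. The elements of $c_0$ are regarded as functions on $\ell_1$ via the pairing $\langle x,y\rangle=\sum_n x_n y_n$, and compact subsets of $\ell_1$ are norm compact. The topology of $\mathscr{S}(c_0)$ is equivalently the topology of uniform convergence on norm-null sequences of $\ell_1$; a neighbourhood basis at $0$ is given by the sets $U_{\overline{\alpha}}=\{(x_n)_n\in c_0 : |x_n|\le 1/|\alpha_n| \text{ for every } n\}$ (no condition where $\alpha_n=0$), where $\overline{\alpha}=(\alpha_n)_n$ ranges over sequences of numbers converging to $0$. A locally convex space is a Schwartz space if it can be represented as a projective limit of Banach spaces with compact linking maps. *)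

theory Defs
  imports "HOL-Analysis.Analysis" "HOL-Algebra.Group"
begin

section \<open>Complex Hilbert spaces and their unitary groups\<close>

text \<open>
  A complex inner product space is a real one together with a compatible complex scalar
  multiplication and a sesquilinear form (linear in the first argument) whose real part is the
  real inner product. Positive definiteness and the norm are thus those of \<^class>\<open>real_inner\<close>.
\<close>

class complex_inner = real_inner +
  fixes scaleC :: "complex \<Rightarrow> 'a \<Rightarrow> 'a"
    and cinner :: "'a \<Rightarrow> 'a \<Rightarrow> complex"
  assumes scaleC_of_real: "scaleC (complex_of_real r) x = r *\<^sub>R x"
    and scaleC_scaleC: "scaleC a (scaleC b x) = scaleC (a * b) x"
    and scaleC_add_left: "scaleC (a + b) x = scaleC a x + scaleC b x"
    and scaleC_add_right: "scaleC a (x + y) = scaleC a x + scaleC a y"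
    and cinner_commute: "cinner x y = cnj (cinner y x)"
    and cinner_add_left: "cinner (x + y) z = cinner x z + cinner y z"
    and cinner_scaleC_left: "cinner (scaleC a x) y = a * cinner x y"
    and Re_cinner: "Re (cinner x y) = inner x y"

class complex_hilbert_space = complex_inner + complete_space

instantiation complex :: complex_hilbert_space
begin

definition scaleC_complex :: "complex \<Rightarrow> complex \<Rightarrow> complex"
  where "scaleC_complex a x = a * x"

definition cinner_complex :: "complex \<Rightarrow> complex \<Rightarrow> complex"
  where "cinner_complex x y = x * cnj y"

instance
  by standard
    (auto simp: scaleC_complex_def cinner_complex_def inner_complex_def scaleR_conv_of_real
      algebra_simps)

end

definition unitary :: "('h::complex_inner \<Rightarrow> 'h) \<Rightarrow> bool"
  where "unitary u \<longleftrightarrow>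
    (\<forall>x y. u (x + y) = u x + u y) \<and>
    (\<forall>c x. u (scaleC c x) = scaleC c (u x)) \<and>
    (\<forall>x y. cinner (u x) (u y) = cinner x y) \<and>
    surj u"

definition unitary_group :: "('h::complex_inner \<Rightarrow> 'h) monoid"
  where "unitary_group = \<lparr>carrier = {u. unitary u}, mult = (\<circ>), one = id\<rparr>"

text \<open>The strong operator topology is that of pointwise convergence with respect to the norm.\<close>

definition strong_operator_topology :: "('h::complex_inner \<Rightarrow> 'h) topology"
  where "strong_operator_topology =
    subtopology (product_topology (\<lambda>_. euclidean) UNIV) {u. unitary u}"

lemma unitary_inj: "unitary u \<Longrightarrow> inj u"
proof (rule injI)
  fix x y assume u: "unitary u" and eq: "u x = u y"
  have "u (x - y) + u y = u x"
    using u unfolding unitary_def by (metis diff_add_cancel)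
  then have "u (x - y) = 0"
    using eq by simp
  moreover have "inner (u (x - y)) (u (x - y)) = inner (x - y) (x - y)"
    using u unfolding unitary_def by (metis Re_cinner)
  ultimately show "x = y"
    by simp
qed

lemma group_unitary_group: "group (unitary_group :: ('h::complex_inner \<Rightarrow> 'h) monoid)"
proof (rule groupI)
  fix u :: "'h \<Rightarrow> 'h"
  assume "u \<in> carrier unitary_group"
  then have u: "unitary u"
    by (simp add: unitary_group_def)
  define v where "v = inv_into UNIV u"
  have r: "u (v x) = x" and l: "v (u x) = x" for x
    using u unitary_inj[OF u] by (auto simp: unitary_def v_def surj_f_inv_f)
  have "unitary v"
    unfolding unitary_def
  proof (intro conjI allI)
    fix x y c
    show "v (x + y) = v x + v y"
      using u r l unfolding unitary_def by metis
    show "v (scaleC c x) = scaleC c (v x)"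
      using u r l unfolding unitary_def by metis
    show "cinner (v x) (v y) = cinner x y"
      using u r unfolding unitary_def by metis
    show "surj v"
      by (metis l surjI)
  qed
  then show "\<exists>v\<in>carrier unitary_group. v \<otimes>\<^bsub>unitary_group\<^esub> u = \<one>\<^bsub>unitary_group\<^esub>"
    using l by (intro bexI[of _ v]) (auto simp: unitary_group_def fun_eq_iff)
next
  fix u v :: "'h \<Rightarrow> 'h"
  assume "u \<in> carrier unitary_group" "v \<in> carrier unitary_group"
  then show "u \<otimes>\<^bsub>unitary_group\<^esub> v \<in> carrier unitary_group"
    using comp_surj[of v u] by (simp add: unitary_group_def unitary_def)
qed (auto simp: unitary_group_def unitary_def fun_eq_iff)


section \<open>Unitary representability\<close>

text \<open>
  The Hilbert space is given by a type, so representability in some Hilbert space is existence of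
  a type of class \<^class>\<open>complex_hilbert_space\<close> such that the following holds.
\<close>

definition unitarily_representable_in ::
    "'h::complex_hilbert_space itself \<Rightarrow> ('g, 'm) monoid_scheme \<Rightarrow> 'g topology \<Rightarrow> bool"
  where "unitarily_representable_in (_ :: 'h itself) G T \<longleftrightarrow>
    (\<exists>S f. subgroup S (unitary_group :: ('h \<Rightarrow> 'h) monoid) \<and>
      f \<in> iso G (unitary_group\<lparr>carrier := S\<rparr>) \<and>
      homeomorphic_map T (subtopology strong_operator_topology S) f)"


section \<open>The space $c_0$ with uniform convergence on the compact subsets of $\ell_1$\<close>

text \<open>
  The scalars form a complete normed field over the reals; by the Gelfand-Mazur theorem this
  means the real or the complex numbers.
\<close>

definition c0 :: "(nat \<Rightarrow> 'k::{real_normed_field, banach}) set"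
  where "c0 = {x. x \<longlonglongrightarrow> 0}"

definition c0_group :: "(nat \<Rightarrow> 'k::{real_normed_field, banach}) monoid"
  where "c0_group = \<lparr>carrier = c0, mult = (\<lambda>x y n. x n + y n), one = (\<lambda>_. 0)\<rparr>"

definition l1 :: "(nat \<Rightarrow> 'k::{real_normed_field, banach}) set"
  where "l1 = {y. y abs_summable_on UNIV}"

definition l1_dist :: "(nat \<Rightarrow> 'k::{real_normed_field, banach}) \<Rightarrow> (nat \<Rightarrow> 'k) \<Rightarrow> real"
  where "l1_dist y z = (\<Sum>\<^sub>\<infinity>n. norm (y n - z n))"

definition l1_topology :: "(nat \<Rightarrow> 'k::{real_normed_field, banach}) topology"
  where "l1_topology = Metric_space.mtopology l1 l1_dist"

definition pairing :: "(nat \<Rightarrow> 'k::{real_normed_field, banach}) \<Rightarrow> (nat \<Rightarrow> 'k) \<Rightarrow> 'k"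
  where "pairing x y = (\<Sum>\<^sub>\<infinity>n. x n * y n)"

text \<open>
  The translates of the following sets form a neighbourhood basis of the topology of uniform
  convergence on compact sets, since finite unions of compact sets are compact.
\<close>

definition uniform_nbhd ::
    "(nat \<Rightarrow> 'k::{real_normed_field, banach}) set \<Rightarrow> real \<Rightarrow> (nat \<Rightarrow> 'k) \<Rightarrow> (nat \<Rightarrow> 'k) set"
  where "uniform_nbhd K e x = {z \<in> c0. \<forall>y\<in>K. norm (pairing (\<lambda>n. z n - x n) y) < e}"

definition tau_k :: "(nat \<Rightarrow> 'k::{real_normed_field, banach}) topology"
  where "tau_k = topology (\<lambda>U. U \<subseteq> c0 \<and>
    (\<forall>x\<in>U. \<exists>K e. compactin l1_topology K \<and> e > 0 \<and> uniform_nbhd K e x \<subseteq> U))"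

lemma abs_summable_diff_l1:
  fixes y z :: "nat \<Rightarrow> 'k::{real_normed_field, banach}"
  assumes "y \<in> l1" "z \<in> l1"
  shows "(\<lambda>n. norm (y n - z n)) summable_on UNIV"
proof (rule summable_on_comparison_test)
  show "(\<lambda>n. norm (y n) + norm (z n)) summable_on UNIV"
    using assms by (auto simp: l1_def intro: summable_on_add)
qed (auto simp: norm_triangle_ineq4)

lemma Metric_space_l1: "Metric_space (l1 :: (nat \<Rightarrow> 'k::{real_normed_field, banach}) set) l1_dist"
proof
  fix x y z :: "nat \<Rightarrow> 'k"
  show "0 \<le> l1_dist x y"
    by (simp add: l1_dist_def infsum_nonneg)
  show "l1_dist x y = l1_dist y x"
    by (simp add: l1_dist_def norm_minus_commute)
  assume x: "x \<in> l1" and y: "y \<in> l1"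
  have "x = y" if "l1_dist x y = 0"
  proof
    fix n
    have "norm (x n - y n) = 0"
      using that by (intro nonneg_infsum_le_0D[where A = UNIV and f = "\<lambda>n. norm (x n - y n)"])
        (auto simp: l1_dist_def abs_summable_diff_l1 x y)
    then show "x n = y n"
      by simp
  qed
  then show "l1_dist x y = 0 \<longleftrightarrow> x = y"
    by (auto simp: l1_dist_def)
  assume z: "z \<in> l1"
  have "norm (x n - z n) \<le> norm (x n - y n) + norm (y n - z n)" for n
    using norm_triangle_ineq[of "x n - y n" "y n - z n"] by simp
  then have "l1_dist x z \<le> (\<Sum>\<^sub>\<infinity>n. norm (x n - y n) + norm (y n - z n))"
    unfolding l1_dist_def
    by (intro infsum_mono summable_on_add abs_summable_diff_l1 x y z)
  also have "\<dots> = l1_dist x y + l1_dist y z"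
    unfolding l1_dist_def by (intro infsum_add abs_summable_diff_l1 x y z)
  finally show "l1_dist x z \<le> l1_dist x y + l1_dist y z" .
qed

lemma openin_tau_k:
  fixes U :: "(nat \<Rightarrow> 'k::{real_normed_field, banach}) set"
  shows "openin tau_k U \<longleftrightarrow> U \<subseteq> c0 \<and>
    (\<forall>x\<in>U. \<exists>K e. compactin l1_topology K \<and> e > 0 \<and> uniform_nbhd K e x \<subseteq> U)"
proof -
  have "istopology (\<lambda>U::(nat \<Rightarrow> 'k) set. U \<subseteq> c0 \<and>
    (\<forall>x\<in>U. \<exists>K e. compactin l1_topology K \<and> e > 0 \<and> uniform_nbhd K e x \<subseteq> U))"
    unfolding istopology_def
  proof (intro conjI allI impI ballI; (elim conjE)?)
    fix U V :: "(nat \<Rightarrow> 'k) set" and x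
    assume U: "\<forall>x\<in>U. \<exists>K e. compactin l1_topology K \<and> e > 0 \<and> uniform_nbhd K e x \<subseteq> U"
      and V: "\<forall>x\<in>V. \<exists>K e. compactin l1_topology K \<and> e > 0 \<and> uniform_nbhd K e x \<subseteq> V"
      and x: "x \<in> U \<inter> V"
    from U x obtain K d where K: "compactin l1_topology K" "d > 0" "uniform_nbhd K d x \<subseteq> U"
      by blast
    from V x obtain L e where L: "compactin l1_topology L" "e > 0" "uniform_nbhd L e x \<subseteq> V"
      by blast
    have "uniform_nbhd (K \<union> L) (min d e) x \<subseteq> U \<inter> V"
      using K(3) L(3) unfolding uniform_nbhd_def by auto
    with K L show "\<exists>K e. compactin l1_topology K \<and> e > 0 \<and> uniform_nbhd K e x \<subseteq> U \<inter> V"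
      by (intro exI[of _ "K \<union> L"] exI[of _ "min d e"]) (auto intro: compactin_Un)
  next
    fix F :: "(nat \<Rightarrow> 'k) set set" and x
    assume F: "\<forall>U\<in>F. U \<subseteq> c0 \<and>
      (\<forall>x\<in>U. \<exists>K e. compactin l1_topology K \<and> e > 0 \<and> uniform_nbhd K e x \<subseteq> U)"
    show "\<Union>F \<subseteq> c0"
      using F by blast
    assume "x \<in> \<Union>F"
    then obtain U where "U \<in> F" "x \<in> U"
      by blast
    with F obtain K e where "compactin l1_topology K" "e > 0" "uniform_nbhd K e x \<subseteq> U"
      by blast
    with \<open>U \<in> F\<close> show "\<exists>K e. compactin l1_topology K \<and> e > 0 \<and> uniform_nbhd K e x \<subseteq> \<Union>F"
      by blast
  qed blast
  then show ?thesis
    by (simp add: tau_k_def)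
qed

lemma topspace_tau_k: "topspace tau_k = c0"
proof
  show "topspace tau_k \<subseteq> c0"
    using openin_topspace[of tau_k] unfolding openin_tau_k by blast
  have "openin tau_k c0"
    unfolding openin_tau_k
    by (auto intro!: exI[of _ "{}"] exI[of _ "1::real"] simp: uniform_nbhd_def)
  then show "c0 \<subseteq> topspace tau_k"
    by (rule openin_subset)
qed

lemma group_c0_group: "group (c0_group :: (nat \<Rightarrow> 'k::{real_normed_field, banach}) monoid)"
proof (rule groupI)
  fix x :: "nat \<Rightarrow> 'k"
  assume "x \<in> carrier c0_group"
  then have "(\<lambda>n. - x n) \<in> carrier c0_group"
    using tendsto_minus[of x 0] by (auto simp: c0_group_def c0_def)
  then show "\<exists>y\<in>carrier c0_group. y \<otimes>\<^bsub>c0_group\<^esub> x = \<one>\<^bsub>c0_group\<^esub>"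
    by (rule bexI[rotated]) (simp add: c0_group_def)
qed (auto simp: c0_group_def c0_def add.assoc intro: tendsto_add_zero)

end

theory Submission imports Defs begin

text \<open>
  Suppose $f$ were a topological embedding of $c_0$ into a unitary group. The weights
  $1/\sqrt{n+1}$ tend to $0$, so the box $|x_n| < \sqrt{n+1}$ (with a uniform margin) is a
  neighbourhood of $0$. Hence finitely many vectors $\xi \in F$ and a $\delta > 0$ detect it: if
  $|x_n| \ge \sqrt{n+1}$ for some $n$, then $f(x)$ moves some $\xi \in F$ by at least $\delta$. In
  the other direction $f$ is continuous for the supremum norm, so for some $r > 0$ the ball of
  radius $r$ moves every $\xi \in F$ by at most $\delta/4$.

  These two facts contradict each other by a cotype 2 argument in the Hilbert space. Let $e_n$ be
  the unit vectors. Starting from $\xi_0 = \xi$, put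
  $\xi_{n+1} = \frac12 (f(r e_n)\xi_n + f(-r e_n)\xi_n)$. Then $\xi_n$ is the mean of the vectors
  $f(r\sum_{m<n} \pm e_m)\xi$ over all choices of signs. As all these sign sums have norm at most
  $r$ in $c_0$, however large $n$ is, $\xi_n$ stays within $\delta/4$ of $\xi$
  (\<open>rep_sign_average_close\<close>). On the other hand, by the parallelogram law the passage from
  $\xi_n$ to $\xi_{n+1}$ decreases the squared norm by $\frac14 \|f(2r e_n)\xi_n - \xi_n\|^2$, so that
  these displacements are square summable (\<open>sum_sign_average_displacement_le\<close>).

  If $k_n$ steps of length $2r$ along $e_n$ reach beyond $\sqrt{n+1}$, they move some
  $\xi \in F$ by at least $\delta$, hence its average $\xi_n$ by at least $\delta/2$, and a single
  step moves $\xi_n$ by at least $\delta/(2k_n)$. Therefore $\sum_n 1/k_n^2$ converges. But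
  $k_n$ may be taken of order $\sqrt{n+1}$, and the harmonic series diverges.
\<close>

section \<open>Orthogonal representations of $c_0$\<close>

definition axis_vec :: "nat \<Rightarrow> real \<Rightarrow> nat \<Rightarrow> 'k::{real_normed_field, banach}"
  where "axis_vec n t = (\<lambda>m. if m = n then of_real t else 0)"

lemma axis_vec_c0: "axis_vec n t \<in> c0"
proof -
  have "eventually (\<lambda>m. axis_vec n t m = (0::'a)) sequentially"
    using eventually_gt_at_top[of n] by eventually_elim (simp add: axis_vec_def)
  then show ?thesis
    unfolding c0_def by (simp add: tendsto_eventually)
qed

lemma c0_add: "x \<in> c0 \<Longrightarrow> y \<in> c0 \<Longrightarrow> (\<lambda>n. x n + y n) \<in> c0"
  by (auto simp: c0_def intro: tendsto_add_zero)

lemma axis_vec_0: "axis_vec n 0 = (\<lambda>_. 0)"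
  by (auto simp: axis_vec_def)

lemma axis_vec_add: "(\<lambda>m. axis_vec n s m + axis_vec n t m) = axis_vec n (s + t)"
  by (auto simp: axis_vec_def)

text \<open>
  Cotype is a matter of the real inner product, on which unitary operators act by linear
  isometries. Continuity enters through explicit estimates on single vectors.
\<close>

locale c0_orthogonal_rep =
  fixes \<pi> :: "(nat \<Rightarrow> 'k::{real_normed_field, banach}) \<Rightarrow> 'h::real_inner \<Rightarrow> 'h"
  assumes linear_rep: "x \<in> c0 \<Longrightarrow> linear (\<pi> x)"
    and norm_rep: "x \<in> c0 \<Longrightarrow> norm (\<pi> x \<eta>) = norm \<eta>"
    and rep_add: "x \<in> c0 \<Longrightarrow> y \<in> c0 \<Longrightarrow> \<pi> (\<lambda>n. x n + y n) \<eta> = \<pi> x (\<pi> y \<eta>)"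
    and rep_0: "\<pi> (\<lambda>_. 0) \<eta> = \<eta>"
begin

lemma rep_axis_add: "\<pi> (axis_vec n s) (\<pi> (axis_vec n t) \<eta>) = \<pi> (axis_vec n (s + t)) \<eta>"
  by (simp add: rep_add[symmetric] axis_vec_c0 axis_vec_add)

lemma norm_rep_diff: "x \<in> c0 \<Longrightarrow> norm (\<pi> x \<eta> - \<pi> x \<zeta>) = norm (\<eta> - \<zeta>)"
  by (metis linear_diff linear_rep norm_rep)

text \<open>
  The mean of $\pi(r \sum_{m<n} \pm e_m)\xi$ over all $2^n$ choices of signs, produced one
  coordinate at a time.
\<close>

primrec sign_average :: "real \<Rightarrow> 'h \<Rightarrow> nat \<Rightarrow> 'h" where
  "sign_average r \<xi> 0 = \<xi>"
| "sign_average r \<xi> (Suc n) =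
    (1/2) *\<^sub>R (\<pi> (axis_vec n r) (sign_average r \<xi> n) + \<pi> (axis_vec n (- r)) (sign_average r \<xi> n))"

text \<open>
  The parallelogram law for $u = \pi(r e_n)\xi_n$ and $v = \pi(-r e_n)\xi_n$, both of the norm of
  $\xi_n$: half their sum is the next average, and $\pi(r e_n)$ maps their difference isometrically
  to $\pi(2r e_n)\xi_n - \xi_n$.
\<close>

lemma norm_sign_average_Suc:
  "4 * (norm (sign_average r \<xi> (Suc n)))\<^sup>2 +
    (norm (\<pi> (axis_vec n (2 * r)) (sign_average r \<xi> n) - sign_average r \<xi> n))\<^sup>2
    = 4 * (norm (sign_average r \<xi> n))\<^sup>2"
proof -
  define \<eta> where "\<eta> = sign_average r \<xi> n"
  define u where "u = \<pi> (axis_vec n r) \<eta>"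
  define v where "v = \<pi> (axis_vec n (- r)) \<eta>"
  have "norm (\<pi> (axis_vec n (2 * r)) \<eta> - \<eta>) = norm (\<pi> (axis_vec n r) u - \<pi> (axis_vec n r) v)"
    by (simp add: u_def v_def rep_axis_add axis_vec_0 rep_0)
  also have "\<dots> = norm (u - v)"
    by (simp add: norm_rep_diff axis_vec_c0)
  finally have "(norm (u + v))\<^sup>2 + (norm (\<pi> (axis_vec n (2 * r)) \<eta> - \<eta>))\<^sup>2
      = 2 * (norm u)\<^sup>2 + 2 * (norm v)\<^sup>2"
    by (simp add: power2_norm_eq_inner inner_add_left inner_add_right inner_diff_left
        inner_diff_right inner_commute)
  moreover have "norm u = norm \<eta>" "norm v = norm \<eta>"
    by (simp_all add: u_def v_def norm_rep axis_vec_c0)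
  moreover have "sign_average r \<xi> (Suc n) = (1/2) *\<^sub>R (u + v)"
    by (simp add: u_def v_def \<eta>_def)
  ultimately show ?thesis
    by (simp add: \<eta>_def[symmetric] power_divide)
qed

text \<open>
  The losses of squared norm telescope. The bound does not depend on \<^term>\<open>N\<close>; this is the
  cotype 2 property of Hilbert spaces, which $c_0$ lacks.
\<close>

lemma sum_sign_average_displacement_le:
  "(\<Sum>n<N. (norm (\<pi> (axis_vec n (2 * r)) (sign_average r \<xi> n) - sign_average r \<xi> n))\<^sup>2)
    \<le> 4 * (norm \<xi>)\<^sup>2"
proof -
  have "(\<Sum>n<N. (norm (\<pi> (axis_vec n (2 * r)) (sign_average r \<xi> n) - sign_average r \<xi> n))\<^sup>2)
      + 4 * (norm (sign_average r \<xi> N))\<^sup>2 = 4 * (norm \<xi>)\<^sup>2"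
  proof (induction N)
    case (Suc N)
    then show ?case
      using norm_sign_average_Suc[of r \<xi> N] by (simp del: sign_average.simps(2))
  qed simp
  then show ?thesis
    using zero_le_power2[of "norm (sign_average r \<xi> N)"] by linarith
qed

text \<open>
  Only the case $x = 0$ is wanted, that is, closeness of the average to \<^term>\<open>\<xi>\<close>. For the
  induction \<^term>\<open>x\<close> must be allowed to carry the signs already expanded: applying
  $\pi(x)$ to the average at $n+1$ leads to the averages at $n$ with $x \pm r e_n$ in place of
  $x$. As $x$ vanishes at $n$, these again have supremum norm at most $r$. Here the geometry of $c_0$
  enters.
\<close>

lemma rep_sign_average_close:
  assumes close: "\<And>x. x \<in> c0 \<Longrightarrow> (\<And>m. norm (x m) \<le> r) \<Longrightarrow> norm (\<pi> x \<xi> - \<xi>) \<le> \<epsilon>"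
    and "r \<ge> 0" "x \<in> c0" "\<And>m. norm (x m) \<le> r" "\<And>m. m < n \<Longrightarrow> x m = 0"
  shows "norm (\<pi> x (sign_average r \<xi> n) - \<xi>) \<le> \<epsilon>"
  using assms(3-5)
proof (induction n arbitrary: x)
  case 0
  then show ?case
    by (simp add: close)
next
  case (Suc n)
  define \<eta> where "\<eta> = sign_average r \<xi> n"
  have *: "norm (\<pi> x (\<pi> (axis_vec n s) \<eta>) - \<xi>) \<le> \<epsilon>" if "\<bar>s\<bar> = r" for s
  proof -
    have "norm (\<pi> (\<lambda>m. x m + axis_vec n s m) \<eta> - \<xi>) \<le> \<epsilon>"
      unfolding \<eta>_def
    proof (rule Suc.IH)
      show "(\<lambda>m. x m + axis_vec n s m) \<in> c0"
        by (intro c0_add Suc.prems axis_vec_c0)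
      show "norm (x m + axis_vec n s m) \<le> r" for m
        using Suc.prems that by (cases "m = n") (auto simp: axis_vec_def)
      show "x m + axis_vec n s m = 0" if "m < n" for m
        using Suc.prems that by (auto simp: axis_vec_def)
    qed
    then show ?thesis
      by (simp add: rep_add Suc.prems axis_vec_c0)
  qed
  define u where "u = \<pi> x (\<pi> (axis_vec n r) \<eta>) - \<xi>"
  define v where "v = \<pi> x (\<pi> (axis_vec n (- r)) \<eta>) - \<xi>"
  have "\<pi> x (sign_average r \<xi> (Suc n)) = (1/2) *\<^sub>R ((u + \<xi>) + (v + \<xi>))"
    using linear_rep[OF Suc.prems(1)] by (simp add: \<eta>_def u_def v_def linear_add linear_scale)
  also have "\<dots> = (1/2) *\<^sub>R u + (1/2) *\<^sub>R v + (1/2) *\<^sub>R (\<xi> + \<xi>)"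
    by (simp only: scaleR_right_distrib add_ac)
  finally have "\<pi> x (sign_average r \<xi> (Suc n)) - \<xi> = (1/2) *\<^sub>R u + (1/2) *\<^sub>R v"
    by simp
  also have "norm \<dots> \<le> (1/2) * norm u + (1/2) * norm v"
    by (rule order_trans[OF norm_triangle_ineq]) simp
  also have "\<dots> \<le> \<epsilon>"
    using *[of r] *[of "- r"] \<open>r \<ge> 0\<close> by (simp add: u_def v_def)
  finally show ?case .
qed

lemma norm_rep_axis_multiple:
  "norm (\<pi> (axis_vec n (real k * t)) \<eta> - \<eta>) \<le> real k * norm (\<pi> (axis_vec n t) \<eta> - \<eta>)"
proof (induction k)
  case 0
  then show ?case
    by (simp add: axis_vec_0 rep_0)
next
  case (Suc k)
  have "\<pi> (axis_vec n (real (Suc k) * t)) \<eta> = \<pi> (axis_vec n t) (\<pi> (axis_vec n (real k * t)) \<eta>)"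
    by (simp add: rep_axis_add algebra_simps)
  then have "norm (\<pi> (axis_vec n (real (Suc k) * t)) \<eta> - \<pi> (axis_vec n t) \<eta>)
      = norm (\<pi> (axis_vec n (real k * t)) \<eta> - \<eta>)"
    by (simp add: norm_rep_diff axis_vec_c0)
  moreover have "norm (\<pi> (axis_vec n (real (Suc k) * t)) \<eta> - \<eta>)
      \<le> norm (\<pi> (axis_vec n (real (Suc k) * t)) \<eta> - \<pi> (axis_vec n t) \<eta>)
        + norm (\<pi> (axis_vec n t) \<eta> - \<eta>)"
    using norm_triangle_ineq[of "\<pi> (axis_vec n (real (Suc k) * t)) \<eta> - \<pi> (axis_vec n t) \<eta>"
        "\<pi> (axis_vec n t) \<eta> - \<eta>"] by simp
  ultimately show ?case
    using Suc.IH by (simp add: algebra_simps)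
qed

text \<open>
  An estimate for the average transfers to \<^term>\<open>\<xi>\<close>: replacing \<^term>\<open>\<xi>\<close> by its average
  changes the displacement by at most twice their distance. The step size $2r$ is the one that the
  parallelogram law controls.
\<close>

lemma norm_rep_axis_le_sign_average:
  assumes close: "\<And>x. x \<in> c0 \<Longrightarrow> (\<And>m. norm (x m) \<le> r) \<Longrightarrow> norm (\<pi> x \<xi> - \<xi>) \<le> \<epsilon>"
    and "r \<ge> 0"
  shows "norm (\<pi> (axis_vec n (real k * (2 * r))) \<xi> - \<xi>)
    \<le> real k * norm (\<pi> (axis_vec n (2 * r)) (sign_average r \<xi> n) - sign_average r \<xi> n) + 2 * \<epsilon>"
proof -
  define \<eta> where "\<eta> = sign_average r \<xi> n"
  define y :: "nat \<Rightarrow> 'k" where "y = axis_vec n (real k * (2 * r))"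
  have "norm (\<pi> (\<lambda>_. 0) \<eta> - \<xi>) \<le> \<epsilon>"
    unfolding \<eta>_def using \<open>r \<ge> 0\<close> axis_vec_c0[of 0 0, unfolded axis_vec_0]
    by (intro rep_sign_average_close[OF close]) auto
  then have near: "norm (\<eta> - \<xi>) \<le> \<epsilon>"
    by (simp add: rep_0)
  have "\<pi> y \<xi> - \<xi> = - (\<pi> y \<eta> - \<pi> y \<xi>) + (\<pi> y \<eta> - \<eta>) + (\<eta> - \<xi>)"
    by simp
  also have "norm \<dots> \<le> norm (\<pi> y \<eta> - \<pi> y \<xi>) + norm (\<pi> y \<eta> - \<eta>) + norm (\<eta> - \<xi>)"
    by (metis norm_triangle_mono norm_minus_cancel norm_triangle_ineq order_refl)
  also have "norm (\<pi> y \<eta> - \<pi> y \<xi>) = norm (\<eta> - \<xi>)"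
    by (simp add: norm_rep_diff axis_vec_c0 y_def)
  finally show ?thesis
    using near norm_rep_axis_multiple[of n k "2 * r" \<eta>] by (simp add: y_def \<eta>_def)
qed

text \<open>
  The vector of \<^term>\<open>F\<close> that is moved by \<^term>\<open>\<delta>\<close> may vary with \<^term>\<open>n\<close>, so the energy
  bounds are added up over the finite set \<^term>\<open>F\<close>. The choice of $\delta/4$ leaves
  $\delta - 2 \cdot \delta/4 = \delta/2$ as a lower bound for the displacement of the averages.
\<close>

lemma summable_inverse_square_of_uniform_displacement:
  fixes k :: "nat \<Rightarrow> nat"
  assumes F: "finite F" and \<delta>: "\<delta> > 0" and r: "r \<ge> 0"
    and k: "\<And>n. k n > 0"
    and close: "\<And>\<xi> x. \<xi> \<in> F \<Longrightarrow> x \<in> c0 \<Longrightarrow> (\<And>m. norm (x m) \<le> r) \<Longrightarrow>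
      norm (\<pi> x \<xi> - \<xi>) \<le> \<delta> / 4"
    and far: "\<And>n. \<exists>\<xi>\<in>F. norm (\<pi> (axis_vec n (real (k n) * (2 * r))) \<xi> - \<xi>) \<ge> \<delta>"
  shows "summable (\<lambda>n. 1 / (real (k n))\<^sup>2)"
proof -
  define D where "D \<xi> n =
    norm (\<pi> (axis_vec n (2 * r)) (sign_average r \<xi> n) - sign_average r \<xi> n)" for \<xi> n
  have D: "(\<delta> / 2)\<^sup>2 * (1 / (real (k n))\<^sup>2) \<le> (\<Sum>\<xi>\<in>F. (D \<xi> n)\<^sup>2)" for n
  proof -
    obtain \<xi> where \<xi>: "\<xi> \<in> F" "norm (\<pi> (axis_vec n (real (k n) * (2 * r))) \<xi> - \<xi>) \<ge> \<delta>"
      using far by blast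
    have "\<delta> \<le> real (k n) * D \<xi> n + 2 * (\<delta> / 4)"
      using norm_rep_axis_le_sign_average[OF close[OF \<xi>(1)] r, of n "k n"] \<xi>(2)
      by (simp add: D_def)
    then have "(\<delta> / 2) / real (k n) \<le> D \<xi> n"
      using k[of n] by (simp add: field_simps)
    then have "((\<delta> / 2) / real (k n))\<^sup>2 \<le> (D \<xi> n)\<^sup>2"
      using \<delta> by (intro power_mono) auto
    also have "\<dots> \<le> (\<Sum>\<xi>\<in>F. (D \<xi> n)\<^sup>2)"
      using F \<xi>(1) by (intro member_le_sum) auto
    finally show ?thesis
      by (simp add: power_divide)
  qed
  have "summable (\<lambda>n. (\<delta> / 2)\<^sup>2 * (1 / (real (k n))\<^sup>2))"
  proof (rule summableI_nonneg_bounded)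
    fix N
    have "(\<Sum>n<N. (\<delta> / 2)\<^sup>2 * (1 / (real (k n))\<^sup>2)) \<le> (\<Sum>n<N. \<Sum>\<xi>\<in>F. (D \<xi> n)\<^sup>2)"
      by (intro sum_mono D)
    also have "\<dots> = (\<Sum>\<xi>\<in>F. \<Sum>n<N. (D \<xi> n)\<^sup>2)"
      by (rule sum.swap)
    also have "\<dots> \<le> (\<Sum>\<xi>\<in>F. 4 * (norm \<xi>)\<^sup>2)"
      unfolding D_def by (intro sum_mono sum_sign_average_displacement_le)
    finally show "(\<Sum>n<N. (\<delta> / 2)\<^sup>2 * (1 / (real (k n))\<^sup>2)) \<le> (\<Sum>\<xi>\<in>F. 4 * (norm \<xi>)\<^sup>2)" .
  qed simp
  then show ?thesis
    using \<delta> by (subst (asm) summable_cmult_iff) auto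
qed

text \<open>
  With $K \ge 1/r$, the number $k_n = K \lceil\sqrt{n+1}\rceil$ of steps of length $2r$ is enough to
  reach beyond $\sqrt{n+1}$, while $1/k_n^2$ is at least a constant multiple of $1/(n+1)$.
\<close>

lemma escaping_displacement_impossible:
  assumes F: "finite F" and \<delta>: "\<delta> > 0" and r: "r > 0"
    and close: "\<And>\<xi> x. \<xi> \<in> F \<Longrightarrow> x \<in> c0 \<Longrightarrow> (\<And>m. norm (x m) \<le> r) \<Longrightarrow>
      norm (\<pi> x \<xi> - \<xi>) \<le> \<delta> / 4"
    and far: "\<And>n t. t \<ge> sqrt (real (Suc n)) \<Longrightarrow> \<exists>\<xi>\<in>F. norm (\<pi> (axis_vec n t) \<xi> - \<xi>) \<ge> \<delta>"
  shows False
proof -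
  define K where "K = nat \<lceil>1 / r\<rceil>"
  have K: "K > 0" "real K * r \<ge> 1"
  proof -
    have "1 / r \<le> real K"
      unfolding K_def by linarith
    then show "real K * r \<ge> 1"
      using r by (simp add: field_simps)
    then show "K > 0"
      by (cases K) auto
  qed
  define c where "c n = nat \<lceil>sqrt (real (Suc n))\<rceil>" for n
  have c: "sqrt (real (Suc n)) \<le> real (c n)" "real (c n) \<le> 2 * sqrt (real (Suc n))" for n
  proof -
    have "1 \<le> sqrt (real (Suc n))"
      by simp
    then show "sqrt (real (Suc n)) \<le> real (c n)" "real (c n) \<le> 2 * sqrt (real (Suc n))"
      unfolding c_def by linarith+
  qed
  have c_pos: "c n > 0" for n
    using c(1)[of n] by (cases "c n") auto
  have "summable (\<lambda>n. 1 / (real (K * c n))\<^sup>2)"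
  proof (rule summable_inverse_square_of_uniform_displacement[OF F \<delta> less_imp_le[OF r] _ close])
    show "0 < K * c n" for n
      using K c_pos by simp
    fix n
    have "sqrt (real (Suc n)) * 1 \<le> real (c n) * (2 * (real K * r))"
      using c(1)[of n] K by (intro mult_mono) auto
    then show "\<exists>\<xi>\<in>F. norm (\<pi> (axis_vec n (real (K * c n) * (2 * r))) \<xi> - \<xi>) \<ge> \<delta>"
      by (intro far) (simp add: algebra_simps)
  qed
  then have "summable (\<lambda>n. (2 * real K)\<^sup>2 * (1 / (real (K * c n))\<^sup>2))"
    by (rule summable_mult)
  then have "summable (\<lambda>n. inverse (real (Suc n)))"
  proof (rule summable_comparison_test'[where N = 0])
    fix n
    have "(real (c n))\<^sup>2 \<le> (2 * sqrt (real (Suc n)))\<^sup>2"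
      by (intro power_mono c) auto
    then have "(real (c n))\<^sup>2 \<le> 4 * real (Suc n)"
      by (simp add: power_mult_distrib)
    then show "norm (inverse (real (Suc n))) \<le> (2 * real K)\<^sup>2 * (1 / (real (K * c n))\<^sup>2)"
      using K(1) c_pos[of n] by (simp add: field_simps power_mult_distrib)
  qed
  then show False
    using not_summable_harmonic[where 'a = real] summable_Suc_iff[of "\<lambda>n. inverse (real n)"]
    by simp
qed

end

section \<open>Unitary groups and their strong operator topology\<close>

lemma c0_orthogonal_rep_of_hom:
  fixes f :: "(nat \<Rightarrow> 'k::{real_normed_field, banach}) \<Rightarrow> 'h::complex_inner \<Rightarrow> 'h"
  assumes "f \<in> hom c0_group unitary_group"
  shows "c0_orthogonal_rep f"
proof (rule c0_orthogonal_rep.intro)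
  have hom: "f (\<lambda>n. x n + y n) = f x \<circ> f y" if "x \<in> c0" "y \<in> c0" for x y
    using hom_mult[OF assms, of x y] that by (simp add: c0_group_def unitary_group_def)
  have unitary: "unitary (f x)" if "x \<in> c0" for x
    using hom_in_carrier[OF assms, of x] that by (simp add: c0_group_def unitary_group_def)
  fix x y :: "nat \<Rightarrow> 'k" and \<eta> :: 'h
  show "f (\<lambda>n. x n + y n) \<eta> = f x (f y \<eta>)" if "x \<in> c0" "y \<in> c0"
    using hom[OF that] by simp
  show "linear (f x)" if "x \<in> c0"
    using unitary[OF that] unfolding unitary_def
    by (intro linearI) (simp_all flip: scaleC_of_real)
  show "norm (f x \<eta>) = norm \<eta>" if "x \<in> c0"
    using unitary[OF that] by (simp add: unitary_def norm_eq_sqrt_inner flip: Re_cinner)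
  have zero: "(\<lambda>_. 0::'k) \<in> c0"
    by (simp add: c0_def)
  have "f (\<lambda>_. 0) (f (\<lambda>_. 0) \<eta>) = f (\<lambda>_. 0) \<eta>"
    using fun_cong[OF hom[OF zero zero], of \<eta>] by simp
  then show "f (\<lambda>_. 0) \<eta> = \<eta>"
    using unitary_inj[OF unitary[OF zero]] by (simp add: inj_eq)
qed

lemma openin_strong_operator_nbhd:
  fixes F :: "'h::complex_inner set"
  assumes "finite F"
  shows "openin strong_operator_topology {u. unitary u \<and> (\<forall>\<xi>\<in>F. norm (u \<xi> - \<xi>) < \<epsilon>)}"
proof -
  have "openin (product_topology (\<lambda>_. euclidean) UNIV)
      (PiE UNIV (\<lambda>\<xi>::'h. if \<xi> \<in> F then ball \<xi> \<epsilon> else UNIV))"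
    using assms by (intro product_topology_basis) (auto intro: finite_subset[of _ F])
  moreover have "{u. unitary u \<and> (\<forall>\<xi>\<in>F. norm (u \<xi> - \<xi>) < \<epsilon>)}
      = PiE UNIV (\<lambda>\<xi>::'h. if \<xi> \<in> F then ball \<xi> \<epsilon> else UNIV) \<inter> {u. unitary u}"
    by (auto simp: PiE_iff dist_norm norm_minus_commute split: if_splits)
  ultimately show ?thesis
    unfolding strong_operator_topology_def by (auto simp: openin_subtopology)
qed

lemma strong_operator_nbhd_subset:
  fixes W :: "('h::complex_inner \<Rightarrow> 'h) set"
  assumes "openin strong_operator_topology W" "id \<in> W"
  obtains F \<delta> where "finite F" "\<delta> > 0"
    "{u. unitary u \<and> (\<forall>\<xi>\<in>F. norm (u \<xi> - \<xi>) < \<delta>)} \<subseteq> W"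
proof -
  obtain V where V: "openin (product_topology (\<lambda>_. euclidean) UNIV) V"
      "W = V \<inter> {u. unitary u}"
    using assms(1) unfolding strong_operator_topology_def openin_subtopology by blast
  then obtain A where A: "finite {\<xi>::'h. A \<xi> \<noteq> UNIV}" "\<And>\<xi>. open (A \<xi>)"
      "id \<in> PiE UNIV A" "PiE UNIV A \<subseteq> V"
    using assms(2) by (auto simp: openin_product_topology_alt)
  let ?F = "{\<xi>. A \<xi> \<noteq> UNIV}"
  have "\<exists>e>0. ball \<xi> e \<subseteq> A \<xi>" for \<xi>
    using A(2)[of \<xi>] A(3) by (auto simp: open_contains_ball PiE_iff)
  then obtain e where e: "\<And>\<xi>. e \<xi> > 0" "\<And>\<xi>. ball \<xi> (e \<xi>) \<subseteq> A \<xi>"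
    by metis
  define \<delta> where "\<delta> = Min (insert 1 (e ` ?F))"
  have "\<delta> > 0"
    using A(1) e(1) by (auto simp: \<delta>_def)
  moreover have \<delta>_le: "\<delta> \<le> e \<xi>" if "\<xi> \<in> ?F" for \<xi>
    using A(1) that by (auto simp: \<delta>_def intro!: Min_le)
  have "u \<in> W" if "unitary u" "\<forall>\<xi>\<in>?F. norm (u \<xi> - \<xi>) < \<delta>" for u
  proof -
    have "u \<xi> \<in> A \<xi>" for \<xi>
    proof (cases "\<xi> \<in> ?F")
      case True
      then have "u \<xi> \<in> ball \<xi> (e \<xi>)"
        using that(2) \<delta>_le[of \<xi>] by (force simp: dist_norm norm_minus_commute)
      then show ?thesis
        using e(2) by blast
    qed simp
    then show ?thesis
      using A(4) V(2) that(1) by (auto simp: PiE_iff)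
  qed
  ultimately show ?thesis
    using A(1) by (intro that[of ?F \<delta>]) auto
qed

section \<open>Neighbourhoods of zero for uniform convergence on compact sets\<close>

lemma pairing_axis_vec: "pairing x (axis_vec n t) = x n * of_real t"
proof -
  have "pairing x (axis_vec n t) = (\<Sum>\<^sub>\<infinity>m\<in>{n}. x m * axis_vec n t m)"
    unfolding pairing_def by (rule infsum_cong_neutral) (auto simp: axis_vec_def)
  then show ?thesis
    by (simp add: axis_vec_def)
qed

lemma axis_vec_l1: "axis_vec n t \<in> l1"
proof -
  have "(\<lambda>m. norm (axis_vec n t m :: 'a)) summable_on UNIV \<longleftrightarrow>
      (\<lambda>m. norm (axis_vec n t m :: 'a)) summable_on {n}"
    by (rule summable_on_cong_neutral) (auto simp: axis_vec_def)
  then show ?thesis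
    by (simp add: l1_def)
qed

lemma l1_dist_axis_vec_0: "l1_dist (axis_vec n t) (\<lambda>_. 0) = \<bar>t\<bar>"
proof -
  have "l1_dist (axis_vec n t :: nat \<Rightarrow> 'a) (\<lambda>_. 0) = (\<Sum>\<^sub>\<infinity>m\<in>{n}. norm (axis_vec n t m :: 'a))"
    unfolding l1_dist_def by (rule infsum_cong_neutral) (auto simp: axis_vec_def)
  then show ?thesis
    by (simp add: axis_vec_def)
qed

lemma compactin_null_axis_vecs:
  assumes "t \<longlonglongrightarrow> 0"
  shows "compactin l1_topology
    (insert (\<lambda>_. 0) (range (\<lambda>n. axis_vec n (t n) :: nat \<Rightarrow> 'k::{real_normed_field, banach})))"
proof -
  interpret Metric_space "l1 :: (nat \<Rightarrow> 'k) set" l1_dist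
    by (rule Metric_space_l1)
  have "limitin l1_topology (\<lambda>n. axis_vec n (t n)) (\<lambda>_. 0 :: 'k) sequentially"
    using assms tendsto_rabs_zero[OF assms] axis_vec_l1[of 0 0, unfolded axis_vec_0]
    unfolding l1_topology_def
    by (simp add: limit_metric_sequentially axis_vec_l1 l1_dist_axis_vec_0 LIMSEQ_iff)
  then show ?thesis
    by (rule compactin_sequence_with_limit)
      (use axis_vec_l1 in \<open>auto simp: l1_topology_def\<close>)
qed

text \<open>
  Up to the margin, the box is the polar of the null sequence $t_n e_n$ of $\ell_1$. The uniform margin $s < 1$, in
  place of a strict inequality in every coordinate, makes it visibly open.
\<close>

lemma openin_tau_k_weighted_box:
  fixes t :: "nat \<Rightarrow> real"
  assumes "t \<longlonglongrightarrow> 0"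
  shows "openin tau_k
    {x \<in> c0 :: (nat \<Rightarrow> 'k::{real_normed_field, banach}) set. \<exists>s<1. \<forall>n. norm (x n) * \<bar>t n\<bar> \<le> s}"
    (is "openin tau_k ?W")
  unfolding openin_tau_k
proof (intro conjI ballI)
  let ?K = "insert (\<lambda>_. 0) (range (\<lambda>n. axis_vec n (t n) :: nat \<Rightarrow> 'k))"
  fix x assume "x \<in> ?W"
  then obtain s where s: "s < 1" "\<And>n. norm (x n) * \<bar>t n\<bar> \<le> s"
    by blast
  have "uniform_nbhd ?K ((1 - s) / 2) x \<subseteq> ?W"
  proof
    fix z assume "z \<in> uniform_nbhd ?K ((1 - s) / 2) x"
    then have z: "z \<in> c0" "\<And>n. norm (z n - x n) * \<bar>t n\<bar> < (1 - s) / 2"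
      by (auto simp: uniform_nbhd_def pairing_axis_vec norm_mult)
    have "norm (z n) * \<bar>t n\<bar> \<le> (1 + s) / 2" for n
    proof -
      have "norm (z n) * \<bar>t n\<bar> \<le> (norm (z n - x n) + norm (x n)) * \<bar>t n\<bar>"
        by (intro mult_right_mono) (use norm_triangle_sub[of "z n" "x n"] in auto)
      also have "\<dots> \<le> (1 - s) / 2 + s"
        using z(2)[of n] s(2)[of n] unfolding distrib_right by linarith
      finally show ?thesis
        by (simp add: field_simps)
    qed
    then show "z \<in> ?W"
      using z(1) s(1) by (auto intro!: exI[of _ "(1 + s) / 2"])
  qed
  then show "\<exists>K e. compactin l1_topology K \<and> e > 0 \<and> uniform_nbhd K e x \<subseteq> ?W"
    using compactin_null_axis_vecs[OF assms] s(1)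
    by (intro exI[of _ ?K] exI[of _ "(1 - s) / 2"]) auto
qed auto

lemma norm_pairing_le:
  fixes x y :: "nat \<Rightarrow> 'k::{real_normed_field, banach}"
  assumes "y \<in> l1" "\<And>n. norm (x n) \<le> r"
  shows "norm (pairing x y) \<le> r * l1_dist y (\<lambda>_. 0)"
proof -
  have y: "(\<lambda>n. norm (y n)) summable_on UNIV"
    using assms(1) by (simp add: l1_def)
  have le: "norm (x n * y n) \<le> r * norm (y n)" for n
    by (simp add: norm_mult assms(2) mult_right_mono)
  have ry: "(\<lambda>n. r * norm (y n)) summable_on UNIV"
    by (intro summable_on_cmult_right y)
  have xy: "(\<lambda>n. x n * y n) abs_summable_on UNIV"
    by (rule summable_on_comparison_test[OF ry]) (use le in auto)
  have "norm (pairing x y) \<le> (\<Sum>\<^sub>\<infinity>n. norm (x n * y n))"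
    unfolding pairing_def by (rule norm_infsum_bound[OF xy])
  also have "\<dots> \<le> (\<Sum>\<^sub>\<infinity>n. r * norm (y n))"
    by (rule infsum_mono[OF xy ry le])
  also have "\<dots> = r * l1_dist y (\<lambda>_. 0)"
    by (simp add: l1_dist_def infsum_cmult_right y)
  finally show ?thesis .
qed

text \<open>
  The topology is coarser than that of the supremum norm, because compact subsets of $\ell_1$
  are bounded.
\<close>

lemma tau_k_open_contains_ball:
  fixes V :: "(nat \<Rightarrow> 'k::{real_normed_field, banach}) set"
  assumes "openin tau_k V" "(\<lambda>_. 0) \<in> V"
  obtains r where "r > 0" "{x \<in> c0. \<forall>n. norm (x n) \<le> r} \<subseteq> V"
proof -
  interpret Metric_space "l1 :: (nat \<Rightarrow> 'k) set" l1_dist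
    by (rule Metric_space_l1)
  obtain K e where K: "compactin l1_topology K" "e > 0" "uniform_nbhd K e (\<lambda>_. 0) \<subseteq> V"
    using assms unfolding openin_tau_k by blast
  have "mbounded K"
    using K(1) unfolding l1_topology_def by (rule compactin_imp_mbounded)
  then have "mbounded (insert (\<lambda>_. 0) K)"
    using axis_vec_l1[of 0 0, unfolded axis_vec_0] by (simp add: mbounded_insert)
  then obtain B where B: "B > 0" "K \<subseteq> l1"
      "\<forall>y\<in>insert (\<lambda>_. 0) K. \<forall>z\<in>insert (\<lambda>_. 0) K. l1_dist y z \<le> B"
    unfolding mbounded_alt_pos by blast
  show ?thesis
  proof (rule that[of "e / (2 * B)"])
    show "e / (2 * B) > 0"
      using K(2) B(1) by simp
    show "{x \<in> c0. \<forall>n. norm (x n) \<le> e / (2 * B)} \<subseteq> V"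
    proof safe
      fix x :: "nat \<Rightarrow> 'k"
      assume x: "x \<in> c0" "\<forall>n. norm (x n) \<le> e / (2 * B)"
      have "norm (pairing x y) < e" if "y \<in> K" for y
      proof -
        have "norm (pairing x y) \<le> e / (2 * B) * l1_dist y (\<lambda>_. 0)"
          using B(2) that x(2) by (intro norm_pairing_le) blast+
        also have "\<dots> \<le> e / (2 * B) * B"
          using B(1,3) K(2) that by (intro mult_left_mono) auto
        also have "\<dots> < e"
          using B(1) K(2) by simp
        finally show ?thesis .
      qed
      then show "x \<in> V"
        using K(3) x(1) by (auto simp: uniform_nbhd_def)
    qed
  qed
qed

section \<open>The Schwartz space $\mathscr{S}(c_0)$ is not unitarily representable\<close>

theorem theorem4p3:
  "\<not> unitarily_representable_in TYPE('h::complex_hilbert_space)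
      (c0_group :: (nat \<Rightarrow> 'k::{real_normed_field, banach}) monoid) tau_k"
proof
  assume "unitarily_representable_in TYPE('h)
    (c0_group :: (nat \<Rightarrow> 'k) monoid) tau_k"
  then obtain S and f :: "(nat \<Rightarrow> 'k) \<Rightarrow> 'h \<Rightarrow> 'h"
    where S: "subgroup S (unitary_group :: ('h \<Rightarrow> 'h) monoid)"
      and iso: "f \<in> iso c0_group (unitary_group\<lparr>carrier := S\<rparr>)"
      and homeo: "homeomorphic_map tau_k (subtopology strong_operator_topology S) f"
    unfolding unitarily_representable_in_def by blast
  have "f \<in> hom c0_group unitary_group"
    using iso subgroup.subset[OF S] by (auto simp: iso_def hom_def)
  then interpret c0_orthogonal_rep f
    by (rule c0_orthogonal_rep_of_hom)
  have inS: "f x \<in> S" "unitary (f x)" if "x \<in> c0" for x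
    using iso subgroup.subset[OF S] that
    by (auto simp: iso_def hom_def c0_group_def unitary_group_def Pi_iff)
  have inj: "inj_on f c0"
    using iso by (simp add: iso_def bij_betw_def c0_group_def)
  have zero: "(\<lambda>_. 0::'k) \<in> c0"
    by (simp add: c0_def)
  have f0: "f (\<lambda>_. 0) = id"
    by (simp add: fun_eq_iff rep_0)

  \<comment> \<open>The weights are a null sequence whose squares are not summable.\<close>
  define W :: "(nat \<Rightarrow> 'k) set" where
    "W = {x \<in> c0. \<exists>s<1. \<forall>n. norm (x n) * \<bar>1 / sqrt (real (Suc n))\<bar> \<le> s}"
  have W: "openin tau_k W" "W \<subseteq> c0"
  proof -
    have "(\<lambda>n. 1 / sqrt (real (Suc n))) \<longlonglongrightarrow> 0"
      by (intro tendsto_divide_0[OF tendsto_const] filterlim_at_top_imp_at_infinity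
          filterlim_compose[OF sqrt_at_top] filterlim_compose[OF filterlim_real_sequentially]
          filterlim_Suc)
    then show "openin tau_k W"
      unfolding W_def by (rule openin_tau_k_weighted_box)
  qed (auto simp: W_def)
  have "openin (subtopology strong_operator_topology S) (f ` W)"
    using homeo W homeomorphic_map_openness_eq by blast
  then obtain V where V: "openin strong_operator_topology V" "f ` W = V \<inter> S"
    unfolding openin_subtopology by blast
  have "(\<lambda>_. 0) \<in> W"
    using zero by (auto simp: W_def intro: exI[of _ 0])
  then have "id \<in> V"
    using V(2) f0 by (metis IntD1 imageI)
  then obtain F \<delta> where F: "finite F" "\<delta> > 0"
      "{u. unitary u \<and> (\<forall>\<xi>\<in>F. norm (u \<xi> - \<xi>) < \<delta>)} \<subseteq> V"
    using strong_operator_nbhd_subset[OF V(1)] by blast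
  have far: "\<exists>\<xi>\<in>F. norm (f (axis_vec n t) \<xi> - \<xi>) \<ge> \<delta>" if "t \<ge> sqrt (real (Suc n))" for n t
  proof (rule ccontr)
    assume "\<not> ?thesis"
    then have "f (axis_vec n t) \<in> V \<inter> S"
      using F(3) inS[OF axis_vec_c0] by (force simp: not_le)
    then have "axis_vec n t \<in> W"
      using inj W(2) axis_vec_c0[of n t] unfolding V(2)[symmetric]
      by (auto dest: inj_onD)
    then obtain s where s: "s < 1" "norm (axis_vec n t n :: 'k) * \<bar>1 / sqrt (real (Suc n))\<bar> \<le> s"
      unfolding W_def by blast
    have "1 \<le> t / sqrt (real (Suc n))"
      using that by (simp add: le_divide_eq)
    also have "\<dots> \<le> norm (axis_vec n t n :: 'k) * \<bar>1 / sqrt (real (Suc n))\<bar>"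
      by (simp add: axis_vec_def divide_right_mono)
    finally show False
      using s by linarith
  qed

  define N where "N = {u :: 'h \<Rightarrow> 'h. unitary u \<and> (\<forall>\<xi>\<in>F. norm (u \<xi> - \<xi>) < \<delta> / 4)}"
  have "continuous_map tau_k strong_operator_topology f"
    by (rule continuous_map_into_fulltopology[OF homeomorphic_imp_continuous_map[OF homeo]])
  then have "openin tau_k {x \<in> topspace tau_k. f x \<in> N}"
    unfolding N_def
    by (rule openin_continuous_map_preimage[OF _ openin_strong_operator_nbhd[OF F(1)]])
  moreover have "(\<lambda>_. 0) \<in> {x \<in> topspace tau_k. f x \<in> N}"
    using zero F(2) inS(2)[OF zero] by (simp add: topspace_tau_k f0 N_def)
  ultimately obtain r where r: "r > 0"
      "{x \<in> c0. \<forall>n. norm (x n) \<le> r} \<subseteq> {x \<in> topspace tau_k. f x \<in> N}"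
    by (rule tau_k_open_contains_ball)
  show False
    using F(1,2) r(1)
  proof (rule escaping_displacement_impossible)
    show "norm (f x \<xi> - \<xi>) \<le> \<delta> / 4"
      if "\<xi> \<in> F" "x \<in> c0" "\<And>m. norm (x m) \<le> r" for \<xi> x
      using r(2) that unfolding N_def by (blast intro: less_imp_le)
  qed (rule far)
qed

end
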